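(* There exists an infinite family of $3$-graphs that satisfies the Gerbner–Tompkins–Zhou prediction; in particular, the family $\{J_t: t\ge 3\}$ does. That is, for every $t\ge 3$, the $3$-graph $F=J_t$ has $\chi(F)=2$ and $q(F)<\infty$, and for every integer $s\ge q(F)$, as $n\to\infty$, $$\mathrm{ex}(n,\{F,M_{s+1}^3\})=\max\{|E(H_i)|: 1\le i\le q(F)\}+o(n^2).$$
   Context: A $3$-graph is a $3$-uniform hypergraph. For a family $\mathcal{F}$ of $3$-graphs, $\mathrm{ex}(n,\mathcal{F})$ is the maximum number of edges in an $n$-vertex $3$-graph containing no member of $\mathcal{F}$ as a (not necessarily induced) subgraph. $M_{s+1}^3$ is the $3$-graph consisting of $s+1$ pairwise disjoint edges. $\chi(F)$ is the minimum number of colors in a vertex coloring of $F$ with no monochromatic edge. The full star $J_t$ is the $3$-graph on $t+1$ vertices, consisting of a center vertex $v_0$ and $t$ other vertices, whose edges are all triples containing $v_0$. For a $3$-graph $F$ with $\chi(F)=2$, a strong red–blue coloring of $F$ is a coloring of its vertices with red and blue in which every edge contains exactly one red vertex. $q(F)$ is the minimum number of red vertices over all strong red–blue colorings of $F$, with $q(F)=\infty$ if none exists. The link graph $L_F(v)$ of $v\in V(F)$ is the graph on $V(F)\setminus\{v\}$ whose edges are the pairs $\{x,y\}$ with $\{v,x,y\}\in E(F)$. $T(m,k)$ is the Turán graph: the complete $k$-partite graph on $m$ vertices with part sizes differing by at most $1$ (so $T(m,1)$ has no edges). The $3$-graphs $H_i$ (depending on $F$, $s$, $n$, where $q(F)\le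 s$): order the vertices of $F$ as $1,2,\dots,|V(F)|$ so that $\chi(L_F(1))\ge\chi(L_F(2))\ge\cdots\ge\chi(L_F(|V(F)|))$. For $1\le i\le q(F)$ put $\ell_i=\chi(L_F(i))$. Let $A_1,A_2,B$ be pairwise disjoint sets with $|A_1|=i-1$, $|A_2|=s-(i-1)$, $|B|=n-s$, and place a copy of $T(n-s,\ell_i-1)$ on $B$. Then $H_i$ is the $3$-graph on $A_1\cup A_2\cup B$ whose edges are (1) all triples with one vertex in $A_1$ and two vertices in $B$, and (2) all triples consisting of one vertex of $A_2$ together with the two endpoints of an edge of the copy of $T(n-s,\ell_i-1)$ on $B$. The Gerbner–Tompkins–Zhou conjecture asserts that for every $3$-graph $F$ with $\chi(F)=2$ and every $s\ge q(F)$, the displayed asymptotic equality holds for $n$ sufficiently large. *)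

theory Defs
  imports Complex_Main "HOL-Library.Landau_Symbols" "HOL-Library.Extended_Nat"
begin

datatype 'a hypergraph = Hypergraph (verts: "'a set") (edges: "'a set set")

definition uniform_hypergraph :: "nat \<Rightarrow> 'a hypergraph \<Rightarrow> bool" where
  "uniform_hypergraph r G \<longleftrightarrow>
     finite (verts G) \<and> (\<forall>e\<in>edges G. e \<subseteq> verts G \<and> card e = r)"

definition contains_copy :: "'b hypergraph \<Rightarrow> 'a hypergraph \<Rightarrow> bool" where
  "contains_copy G F \<longleftrightarrow>
     (\<exists>f. inj_on f (verts F) \<and> f ` verts F \<subseteq> verts G \<and> (\<forall>e\<in>edges F. f ` e \<in> edges G))"

definition isomorphic :: "'a hypergraph \<Rightarrow> 'b hypergraph \<Rightarrow> bool" where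
  "isomorphic F G \<longleftrightarrow>
     (\<exists>f. bij_betw f (verts F) (verts G) \<and> edges G = (\<lambda>e. f ` e) ` edges F)"

(* Host graphs may be taken on natural-number vertices without loss of generality.
   The maximum is over a finite set; it is nonempty whenever every member of the
   family has an edge. *)
definition turan_ex :: "nat \<Rightarrow> 'a hypergraph set \<Rightarrow> nat" where
  "turan_ex n \<F> =
     Max {card (edges G) | G :: nat hypergraph.
            uniform_hypergraph 3 G \<and> card (verts G) = n \<and> (\<forall>F\<in>\<F>. \<not> contains_copy G F)}"

definition matching3 :: "nat \<Rightarrow> nat hypergraph" where
  "matching3 m = Hypergraph {..<3 * m} {{3 * j, 3 * j + 1, 3 * j + 2} | j. j < m}"

definition full_star :: "nat \<Rightarrow> nat hypergraph" where
  "full_star t = Hypergraph {..t} {e. e \<subseteq> {..t} \<and> card e = 3 \<and> 0 \<in> e}"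

definition proper_colouring :: "'a hypergraph \<Rightarrow> ('a \<Rightarrow> nat) \<Rightarrow> bool" where
  "proper_colouring G c \<longleftrightarrow> (\<forall>e\<in>edges G. \<exists>x\<in>e. \<exists>y\<in>e. c x \<noteq> c y)"

(* Used both for 3-graphs and for (link) graphs, regarded as 2-uniform hypergraphs,
   where it is the usual chromatic number. *)
definition chromatic_number :: "'a hypergraph \<Rightarrow> nat" where
  "chromatic_number G = (LEAST k. \<exists>c. c ` verts G \<subseteq> {..<k} \<and> proper_colouring G c)"

(* A red-blue colouring is given by its set R of red vertices. *)
definition strong_red_blue :: "'a hypergraph \<Rightarrow> 'a set \<Rightarrow> bool" where
  "strong_red_blue F R \<longleftrightarrow> R \<subseteq> verts F \<and> (\<forall>e\<in>edges F. card (e \<inter> R) = 1)"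

(* The infimum of the empty set in enat is \<infinity>. *)
definition q_number :: "'a hypergraph \<Rightarrow> enat" where
  "q_number F = Inf {enat (card R) | R. strong_red_blue F R}"

definition link :: "'a hypergraph \<Rightarrow> 'a \<Rightarrow> 'a hypergraph" where
  "link F v = Hypergraph (verts F - {v})
     {{x, y} | x y. x \<noteq> y \<and> x \<noteq> v \<and> y \<noteq> v \<and> {v, x, y} \<in> edges F}"

(* The list vs enumerates the vertices with vs ! (i - 1) being the i-th vertex. *)
definition link_ordering :: "'a hypergraph \<Rightarrow> 'a list \<Rightarrow> bool" where
  "link_ordering F vs \<longleftrightarrow> distinct vs \<and> set vs = verts F \<and>
     sorted_wrt (\<lambda>u v. chromatic_number (link F u) \<ge> chromatic_number (link F v)) vs"

lemma ex_link_ordering: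
  assumes "finite (verts F)"
  shows "\<exists>vs. link_ordering F vs"
proof -
  obtain xs where xs: "set xs = verts F" "distinct xs"
    using finite_distinct_list[OF assms] by blast
  define f where "f = (\<lambda>v. chromatic_number (link F v))"
  have "sorted (map f (sort_key f xs))"
    by simp
  then have "sorted_wrt (\<lambda>u v. f u \<ge> f v) (rev (sort_key f xs))"
    by (simp add: sorted_wrt_rev sorted_map)
  then have "link_ordering F (rev (sort_key f xs))"
    using xs by (simp add: link_ordering_def f_def)
  then show ?thesis ..
qed

(* For k > 0 the parts are the residue classes modulo k in {..<m}, whose sizes differ
   by at most 1.  The value at k = 0 is junk. *)
definition turan_graph :: "nat \<Rightarrow> nat \<Rightarrow> nat hypergraph" where
  "turan_graph m k = Hypergraph {..<m} {{x, y} | x y. x < m \<and> y < m \<and> x mod k \<noteq> y mod k}"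

(* Here A1 = {..<i - 1}, A2 = {i - 1..<s} and B = {s..<n}, with the Turan graph
   translated onto B; meaningful for 1 \<le> i \<le> s \<le> n.
   The argument l is the chromatic number of the i-th link. *)
definition H_graph :: "nat \<Rightarrow> nat \<Rightarrow> nat \<Rightarrow> nat \<Rightarrow> nat hypergraph" where
  "H_graph l s n i = Hypergraph {..<n}
     ({{a, x, y} | a x y. a \<in> {..<i - 1} \<and> x \<in> {s..<n} \<and> y \<in> {s..<n} \<and> x \<noteq> y} \<union>
      {insert a ((\<lambda>x. s + x) ` e) | a e.
         a \<in> {i - 1..<s} \<and> e \<in> edges (turan_graph (n - s) (l - 1))})"

definition GTZ_H :: "'a hypergraph \<Rightarrow> 'a list \<Rightarrow> nat \<Rightarrow> nat \<Rightarrow> nat \<Rightarrow> nat hypergraph" where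
  "GTZ_H F vs s n i = H_graph (chromatic_number (link F (vs ! (i - 1)))) s n i"

(* The numbers of edges do not depend on the choice of the ordering vs. *)
definition GTZ_asymptotics :: "nat hypergraph \<Rightarrow> nat \<Rightarrow> bool" where
  "GTZ_asymptotics F s \<longleftrightarrow> (\<forall>vs. link_ordering F vs \<longrightarrow>
     (\<lambda>n. real (turan_ex n {F, matching3 (s + 1)})
          - real (Max {card (edges (GTZ_H F vs s n i)) | i. 1 \<le> i \<and> enat i \<le> q_number F}))
     \<in> o(\<lambda>n. (real n)\<^sup>2))"

definition satisfies_GTZ :: "nat hypergraph \<Rightarrow> bool" where
  "satisfies_GTZ F \<longleftrightarrow>
     chromatic_number F = 2 \<and> q_number F < \<infinity> \<and>
     (\<forall>s. q_number F \<le> enat s \<longrightarrow> GTZ_asymptotics F s)"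

(* Infinitely many 3-graphs, even up to isomorphism. *)
definition infinite_family :: "nat hypergraph set \<Rightarrow> bool" where
  "infinite_family \<F> \<longleftrightarrow>
     infinite \<F> \<and> (\<forall>F\<in>\<F>. uniform_hypergraph 3 F) \<and>
     pairwise (\<lambda>F G. \<not> isomorphic F G) \<F>"

end

theory Submission
  imports Defs
begin

text \<open>
  In the full star \<open>J\<^sub>t\<close> the centre alone is a strong colouring, so \<open>q = 1\<close>, and the link of the
  centre is \<open>K\<^sub>t\<close>; hence \<open>H\<^sub>1\<close> consists of \<open>s\<close> vertices joined to the edges of \<open>T(n - s, t - 1)\<close>.
  This graph is admissible, which is the lower bound. Conversely, let \<open>G\<close> be admissible. The
  vertices of a maximal matching form a bounded set \<open>S\<close> meeting all edges, and only \<open>O(n)\<close> edges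
  meet \<open>S\<close> twice. If \<open>s + 1\<close> vertices of \<open>S\<close> had more than linearly many edges leaving \<open>S\<close>, a greedy
  choice would give a matching of size \<open>s + 1\<close>. So all but \<open>O(n)\<close> edges belong to the links of at
  most \<open>s\<close> vertices; these links are \<open>K\<^sub>t\<close>-free and Turan's theorem bounds them.
\<close>

section \<open>Turan's theorem\<close>

text \<open>Each two-element set comes from exactly two ordered pairs. This converts between edge
  counts and the ordered adjacent pairs in which the Turan bound is phrased.\<close>

lemma card_ordered_pairs:
  assumes "finite N" "\<And>e. e \<in> N \<Longrightarrow> card e = 2"
  shows "card {(x, y). {x, y} \<in> N} = 2 * card N"
proof -
  have 1: "finite {(x, y). {x, y} = e} \<and> card {(x, y). {x, y} = e} = 2" if e: "e \<in> N" for e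
  proof -
    obtain a b where ab: "e = {a, b}" "a \<noteq> b"
      using assms(2)[OF e] by (auto simp: card_2_iff)
    have "{(x, y). {x, y} = e} = {(a, b), (b, a)}"
      using ab by (auto simp: doubleton_eq_iff)
    then show ?thesis using ab by simp
  qed
  have "{(x, y). {x, y} \<in> N} = (\<Union>e\<in>N. {(x, y). {x, y} = e})" by auto
  also have "card \<dots> = (\<Sum>e\<in>N. card {(x, y). {x, y} = e})"
    using assms(1) 1 by (intro card_UN_disjoint) auto
  also have "\<dots> = 2 * card N" using 1 by simp
  finally show ?thesis .
qed

text \<open>
  This is the bound \<open>p \<le> (1 - 1/r) |V|\<^sup>2\<close> for the number \<open>p\<close> of ordered adjacent pairs, with the
  subtraction and the division cleared so that it is meaningful for \<open>r = 0\<close> too.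
\<close>
lemma turan_clique_bound:
  assumes "finite V" "symp E" "irreflp E"
    and "\<And>A. A \<subseteq> V \<Longrightarrow> card A = Suc r \<Longrightarrow> \<exists>x\<in>A. \<exists>y\<in>A. x \<noteq> y \<and> \<not> E x y"
  shows "r * card {(x, y). x \<in> V \<and> y \<in> V \<and> E x y} + (card V)\<^sup>2 \<le> r * (card V)\<^sup>2"
  using assms(1,4)
proof (induction r arbitrary: V)
  case 0
  \<comment> \<open>For \<open>r = 0\<close> the hypothesis already excludes a single
    vertex.\<close>
  have "V = {}"
  proof (rule ccontr)
    assume "V \<noteq> {}"
    then obtain v where "v \<in> V" by auto
    then show False using "0.prems"(2)[of "{v}"] by simp
  qed
  then show ?case by simp
next
  case (Suc r)
  \<comment> \<open>Two nested inductions: the inner one, on subsets of \<open>V\<close>, deletes a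
    clique of size \<open>Suc r\<close> when there is one; otherwise the outer hypothesis for
    \<open>r\<close> applies to \<open>V\<close> itself.\<close>
  note outer = Suc.IH
  show ?case using Suc.prems
  proof (induction V rule: finite_psubset_induct)
    case (psubset V)
    define P where "P = (\<lambda>X Y. {(x, y). x \<in> X \<and> y \<in> Y \<and> E x y})"
    have finP: "finite (P X Y)" if "X \<subseteq> V" "Y \<subseteq> V" for X Y
      using that psubset.hyps
      by (intro finite_subset[of "P X Y" "V \<times> V"]) (auto simp: P_def)
    show ?case
    proof (cases "\<exists>A\<subseteq>V. card A = Suc r \<and> (\<forall>x\<in>A. \<forall>y\<in>A. x \<noteq> y \<longrightarrow> E x y)")
      case True
      then obtain A where A: "A \<subseteq> V" "card A = Suc r" "\<And>x y. x \<in> A \<Longrightarrow> y \<in> A \<Longrightarrow> x \<noteq> y \<Longrightarrow> E x y"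
        by blast
      have finA: "finite A" using A(2) by (simp add: card_ge_0_finite)
      define m where "m = card (V - A)"
      have cV: "card V = m + Suc r"
        using A finA psubset.hyps by (metis add.commute card_Diff_subset card_mono le_add_diff_inverse m_def)
      have "V - A \<subset> V" using A by (metis Diff_subset card.empty double_diff nat.distinct(1) psubsetI Diff_cancel)
      then have IH: "Suc r * card (P (V - A) (V - A)) + m\<^sup>2 \<le> Suc r * m\<^sup>2"
        unfolding m_def P_def using psubset.prems by (intro psubset.IH) auto
      have c1: "card (P A A) \<le> Suc r * r"
      proof -
        have "card (P A A) \<le> card (SIGMA x:A. A - {x})"
          using finA assms(3) by (intro card_mono) (auto simp: P_def irreflp_def)
        also have "\<dots> = Suc r * r" using finA A(2) by simp
        finally show ?thesis .
      qed
      \<comment> \<open>A vertex outside \<open>A\<close> adjacent to all of \<open>A\<close> would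
        give a clique of size \<open>Suc (Suc r)\<close>, so it has at most \<open>r\<close>
        neighbours in \<open>A\<close>.\<close>
      have c2: "card (P (V - A) A) \<le> m * r"
      proof -
        have "P (V - A) A = (SIGMA x:V - A. {y\<in>A. E x y})" by (auto simp: P_def)
        then have "card (P (V - A) A) = (\<Sum>x\<in>V - A. card {y\<in>A. E x y})"
          using finA psubset.hyps by simp
        also have "\<dots> \<le> (\<Sum>x\<in>V - A. r)"
        proof (rule sum_mono)
          fix x assume x: "x \<in> V - A"
          obtain u w where uw: "u \<in> insert x A" "w \<in> insert x A" "u \<noteq> w" "\<not> E u w"
            using psubset.prems[of "insert x A"] x A finA by auto
          then obtain a where "a \<in> A" "\<not> E x a"
            using A(3) assms(2) by (metis insertE sympD)
          then have "{y\<in>A. E x y} \<subset> A" by auto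
          then have "card {y\<in>A. E x y} < card A" by (rule psubset_card_mono[OF finA])
          then show "card {y\<in>A. E x y} \<le> r" using A(2) by simp
        qed
        also have "\<dots> = m * r" by (simp add: m_def)
        finally show ?thesis .
      qed
      have c3: "card (P A (V - A)) = card (P (V - A) A)"
      proof -
        have "P A (V - A) = prod.swap ` P (V - A) A"
          using assms(2) by (auto simp: P_def image_iff dest: sympD)
        then show ?thesis by (simp add: card_image)
      qed
      have "P V V = P (V - A) (V - A) \<union> P A A \<union> P (V - A) A \<union> P A (V - A)"
        using A by (auto simp: P_def)
      then have "card (P V V) \<le>
          card (P (V - A) (V - A)) + card (P A A) + card (P (V - A) A) + card (P A (V - A))"
        using card_Un_le[of "P (V - A) (V - A) \<union> P A A \<union> P (V - A) A" "P A (V - A)"]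
          card_Un_le[of "P (V - A) (V - A) \<union> P A A" "P (V - A) A"]
          card_Un_le[of "P (V - A) (V - A)" "P A A"]
        by (simp only:)
      then have "card (P V V) \<le> card (P (V - A) (V - A)) + Suc r * r + 2 * (m * r)"
        using c1 c2 c3 by linarith
      then have "Suc r * card (P V V) \<le> Suc r * (card (P (V - A) (V - A)) + Suc r * r + 2 * (m * r))"
        by (rule mult_le_mono2)
      \<comment> \<open>The terms are grouped so that the inner hypothesis can be substituted; what
        remains then adds up to exactly \<open>Suc r\<close> times the square of
        \<open>m + Suc r\<close>.\<close>
      then have "Suc r * card (P V V) + (m + Suc r)\<^sup>2
          \<le> (Suc r * card (P (V - A) (V - A)) + m\<^sup>2) + Suc r * (Suc r * r + 2 * (m * r))
            + 2 * m * Suc r + (Suc r)\<^sup>2"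
        by (simp add: algebra_simps power2_eq_square)
      also have "\<dots> \<le> Suc r * m\<^sup>2 + Suc r * (Suc r * r + 2 * (m * r)) + 2 * m * Suc r + (Suc r)\<^sup>2"
        using IH by linarith
      also have "\<dots> = Suc r * (m + Suc r)\<^sup>2"
        by (simp add: algebra_simps power2_eq_square)
      finally show ?thesis by (simp add: P_def cV)
    next
      case False
      then have "r * card (P V V) + (card V)\<^sup>2 \<le> r * (card V)\<^sup>2"
        unfolding P_def using psubset.hyps by (intro outer) blast+
      \<comment> \<open>Passing from \<open>r\<close> to \<open>Suc r\<close> adds one
        \<open>card (P V V)\<close> on the left and one squared \<open>card V\<close> on the right,
        so this trivial bound suffices.\<close>
      moreover have "card (P V V) \<le> (card V)\<^sup>2"
        using card_mono[of "V \<times> V" "P V V"] psubset.hyps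
        by (auto simp: P_def power2_eq_square card_cartesian_product)
      ultimately show ?thesis by (simp add: P_def)
    qed
  qed
qed

text \<open>An ordered pair that is not adjacent lies within one residue class, and a class has at
  most \<open>m div k + 1\<close> elements. So at most \<open>m\<close> squared over
  \<open>k\<close>, plus \<open>m\<close>, ordered pairs are lost; the linear term absorbs the
  rounding.\<close>

lemma card_turan_graph_edges:
  assumes "k \<ge> 1"
  shows "2 * real (card (edges (turan_graph m k))) \<ge> (1 - 1 / real k) * (real m)\<^sup>2 - real m"
proof -
  let ?N = "edges (turan_graph m k)"
  have fin: "finite ?N"
    by (rule finite_subset[of _ "Pow {..<m}"]) (auto simp: turan_graph_def)
  have c2: "card e = 2" if "e \<in> ?N" for e
    using that by (auto simp: turan_graph_def card_2_iff)
  \<comment> \<open>The non-adjacent ordered pairs, including the diagonal.\<close>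
  define Q where "Q = (SIGMA x:{..<m}. {y. y < m \<and> y mod k = x mod k})"
  have "card {y. y < m \<and> y mod k = x mod k} \<le> m div k + 1" for x
  proof -
    \<comment> \<open>Within a residue class \<open>y\<close> is determined by its quotient
      \<open>y div k\<close>, which is at most \<open>m div k\<close>.\<close>
    have "{y. y < m \<and> y mod k = x mod k} \<subseteq> (\<lambda>q. k * q + x mod k) ` {..m div k}"
    proof
      fix y assume "y \<in> {y. y < m \<and> y mod k = x mod k}"
      then have y: "y mod k = x mod k" "y \<le> m" by auto
      have "y = k * (y div k) + x mod k" unfolding y(1)[symmetric] by simp
      moreover have "y div k \<le> m div k" using y(2) by (rule div_le_mono)
      ultimately show "y \<in> (\<lambda>q. k * q + x mod k) ` {..m div k}" by blast
    qed
    then have "card {y. y < m \<and> y mod k = x mod k} \<le> card {..m div k}"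
      by (meson card_image_le card_mono finite_atMost finite_imageI order_trans)
    then show ?thesis by simp
  qed
  then have "card Q \<le> m * (m div k + 1)"
    unfolding Q_def using sum_mono[of "{..<m}" "\<lambda>x. card {y. y < m \<and> y mod k = x mod k}" "\<lambda>_. m div k + 1"]
    by simp
  then have "real (card Q) \<le> real m * (real (m div k) + 1)"
    by (metis of_nat_1 of_nat_add of_nat_le_iff of_nat_mult)
  also have "\<dots> \<le> real m * (real m / real k + 1)"
    by (intro mult_left_mono add_right_mono) (auto simp: of_nat_div_le_of_nat)
  finally have Q: "real (card Q) \<le> (real m)\<^sup>2 / real k + real m"
    by (simp add: algebra_simps power2_eq_square)
  have "{..<m} \<times> {..<m} \<subseteq> {(x, y). {x, y} \<in> ?N} \<union> Q"
    by (auto simp: turan_graph_def Q_def)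
  moreover have finQ: "finite Q" unfolding Q_def by auto
  moreover have "finite {(x, y). {x, y} \<in> ?N}"
    by (rule finite_subset[of _ "{..<m} \<times> {..<m}"]) (auto simp: turan_graph_def doubleton_eq_iff)
  ultimately have "card ({..<m} \<times> {..<m}) \<le> card {(x, y). {x, y} \<in> ?N} + card Q"
    by (meson card_Un_le card_mono finite_Un order_trans)
  then have "m * m \<le> 2 * card ?N + card Q"
    using card_ordered_pairs[OF fin c2] by (simp add: card_cartesian_product)
  then have "real m * real m \<le> 2 * real (card ?N) + real (card Q)"
    by (metis (mono_tags) of_nat_add of_nat_le_iff of_nat_mult of_nat_numeral)
  then show ?thesis using Q by (simp add: algebra_simps power2_eq_square)
qed

section \<open>Matchings\<close>

text \<open>Links the two views of a matching: a set of pairwise disjoint edges, produced by the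
  greedy arguments, and an embedded \<open>matching3 m\<close>, which is what the extremal problem
  forbids.\<close>

lemma contains_matching3I:
  assumes "uniform_hypergraph 3 G" "M \<subseteq> edges G" "finite M" "m \<le> card M" "pairwise disjnt M"
  shows "contains_copy G (matching3 m)"
proof -
  obtain g where g: "bij_betw g {..<card M} M"
    using ex_bij_betw_nat_finite[OF assms(3)] by (auto simp: atLeast0LessThan)
  have gM: "g j \<in> M" if "j < m" for j using g that assms(4) by (auto simp: bij_betw_def)
  have gE: "g j \<in> edges G" if "j < m" for j using gM[OF that] assms(2) by auto
  have "\<exists>h. bij_betw h {..<3::nat} (g j)" if "j < m" for j
  proof -
    have "card (g j) = 3" using gE[OF that] assms(1) by (auto simp: uniform_hypergraph_def)
    moreover from this have "finite (g j)" by (simp add: card_ge_0_finite)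
    ultimately show ?thesis
      using ex_bij_betw_nat_finite[of "g j"] by (simp add: atLeast0LessThan)
  qed
  then obtain h where h: "\<And>j. j < m \<Longrightarrow> bij_betw (h j) {..<3::nat} (g j)" by metis
  \<comment> \<open>Vertex \<open>i\<close> belongs to edge number \<open>i div 3\<close> of
    \<open>matching3 m\<close>; it is sent to entry \<open>i mod 3\<close> of the edge
    \<open>g (i div 3)\<close>.\<close>
  define f where "f = (\<lambda>i. h (i div 3) (i mod 3))"
  have fg: "f i \<in> g (i div 3)" if "i < 3 * m" for i
  proof -
    have "i div 3 < m" using that by (simp add: less_mult_imp_div_less mult.commute)
    from h[OF this] show ?thesis unfolding f_def bij_betw_def by auto
  qed
  have "inj_on f {..<3 * m}"
  proof (rule inj_onI)
    fix i i' assume i: "i \<in> {..<3 * m}" "i' \<in> {..<3 * m}" "f i = f i'"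
    have d: "i div 3 < m" "i' div 3 < m" using i by (auto simp: less_mult_imp_div_less mult.commute)
    have "g (i div 3) = g (i' div 3)"
      using fg[of i] fg[of i'] i assms(5) gM[OF d(1)] gM[OF d(2)]
      by (auto simp: pairwise_def disjnt_iff)
    then have e: "i div 3 = i' div 3"
      using g d assms(4) by (auto simp: bij_betw_def inj_on_def)
    then have "i mod 3 = i' mod 3"
      using i(3) h[OF d(1)] by (auto simp: f_def bij_betw_def inj_on_def)
    with e show "i = i'" by (metis div_mult_mod_eq)
  qed
  moreover have "f ` {..<3 * m} \<subseteq> verts G"
  proof
    fix x assume "x \<in> f ` {..<3 * m}"
    then obtain i where i: "i < 3 * m" "x = f i" by auto
    then have "i div 3 < m" by (simp add: less_mult_imp_div_less mult.commute)
    from gE[OF this] have "g (i div 3) \<subseteq> verts G" using assms(1) by (auto simp: uniform_hypergraph_def)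
    then show "x \<in> verts G" using fg[OF i(1)] i by auto
  qed
  moreover have "f ` {3 * j, 3 * j + 1, 3 * j + 2} \<in> edges G" if "j < m" for j
  proof -
    have "f ` {3 * j, 3 * j + 1, 3 * j + 2} = h j ` {0, 1, 2}"
    proof -
      have "(3 * j + 1) div 3 = j" "(3 * j + 1) mod 3 = 1" "(3 * j + 2) div 3 = j" "(3 * j + 2) mod 3 = 2"
        by presburger+
      then show ?thesis by (simp add: f_def)
    qed
    also have "{0, 1, 2::nat} = {..<3}" by auto
    also have "h j ` {..<3} = g j" using h[OF that] by (simp add: bij_betw_def)
    finally show ?thesis using gE[OF that] by simp
  qed
  ultimately show ?thesis
    unfolding contains_copy_def matching3_def by (intro exI[of _ f]) auto
qed

text \<open>If some edge misses the union of a matching of size \<open>m\<close>, it extends the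
  matching. Otherwise that union, with at most \<open>3 * m\<close> vertices, meets every edge. A
  cover found earlier stays small enough as \<open>m\<close> grows.\<close>

lemma matching_or_cover:
  assumes "uniform_hypergraph 3 G"
  shows "(\<exists>M\<subseteq>edges G. finite M \<and> card M = m \<and> pairwise disjnt M) \<or>
         (\<exists>S\<subseteq>verts G. card S \<le> 3 * m \<and> (\<forall>e\<in>edges G. e \<inter> S \<noteq> {}))"
proof (induction m)
  case 0
  show ?case by (intro disjI1 exI[of _ "{}"]) auto
next
  case (Suc m)
  then show ?case
  proof
    assume "\<exists>M\<subseteq>edges G. finite M \<and> card M = m \<and> pairwise disjnt M"
    then obtain M where M: "M \<subseteq> edges G" "finite M" "card M = m" "pairwise disjnt M" by blast
    show ?thesis
    proof (cases "\<forall>e\<in>edges G. e \<inter> \<Union>M \<noteq> {}")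
      case True
      have "card (\<Union>M) \<le> (\<Sum>e\<in>M. card e)" by (rule card_Union_le_sum_card)
      also have "\<dots> = (\<Sum>e\<in>M. 3)"
        using M(1) assms by (intro sum.cong) (auto simp: uniform_hypergraph_def)
      finally have "card (\<Union>M) \<le> 3 * Suc m" using M(3) by simp
      moreover have "\<Union>M \<subseteq> verts G" using M(1) assms by (auto simp: uniform_hypergraph_def)
      ultimately show ?thesis using True by blast
    next
      case False
      then obtain e where e: "e \<in> edges G" "e \<inter> \<Union>M = {}" by blast
      then have "e \<noteq> {}" using assms by (auto simp: uniform_hypergraph_def)
      then have "e \<notin> M" using e by auto
      then have "card (insert e M) = Suc m" using M by simp
      moreover have "pairwise disjnt (insert e M)"
        using M(4) e(2) by (auto simp: pairwise_insert disjnt_def)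
      ultimately show ?thesis
        using M e by (intro disjI1 exI[of _ "insert e M"]) auto
    qed
  next
    assume "\<exists>S\<subseteq>verts G. card S \<le> 3 * m \<and> (\<forall>e\<in>edges G. e \<inter> S \<noteq> {})"
    then show ?thesis by (intro disjI2) (meson le_SucI mult_le_mono2 order_trans le_add2 lessI less_imp_le)
  qed
qed

text \<open>An edge through given distinct \<open>a\<close> and \<open>b\<close> is determined by
  its third vertex. The bound serves both for edges meeting the cover twice and for edges through a
  fixed vertex that hit an already used one.\<close>

lemma card_edges_through_pair:
  assumes G: "uniform_hypergraph 3 G" and "finite S" "finite T"
    and N: "N \<subseteq> edges G" "\<And>e. e \<in> N \<Longrightarrow> \<exists>a b. a \<in> S \<and> b \<in> T \<and> a \<noteq> b \<and> {a, b} \<subseteq> e"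
  shows "card N \<le> card S * card T * card (verts G)"
proof -
  have finV: "finite (verts G)" using G by (auto simp: uniform_hypergraph_def)
  have "N \<subseteq> (\<lambda>(a, b, c). {a, b, c}) ` (S \<times> T \<times> verts G)"
  proof
    fix e assume e: "e \<in> N"
    then have ce: "card e = 3" "e \<subseteq> verts G" using N(1) G by (auto simp: uniform_hypergraph_def)
    obtain a b where ab: "a \<in> S" "b \<in> T" "a \<noteq> b" "{a, b} \<subseteq> e" using N(2)[OF e] by blast
    have "card (e - {a, b}) = 1" using ab ce by (simp add: card_Diff_subset)
    then obtain c where "e - {a, b} = {c}" by (auto simp: card_1_singleton_iff)
    then have "e = {a, b, c}" "c \<in> verts G" using ab ce by auto
    then show "e \<in> (\<lambda>(a, b, c). {a, b, c}) ` (S \<times> T \<times> verts G)" using ab by force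
  qed
  then have "card N \<le> card (S \<times> T \<times> verts G)"
    using assms(2,3) finV by (meson card_image_le card_mono finite_SigmaI finite_imageI order_trans)
  then show ?thesis by (simp add: card_cartesian_product mult.assoc)
qed

text \<open>Edges are chosen for one \<open>v\<close> after another. Inside \<open>S\<close> their
  traces are distinct singletons, so conflicts occur only outside \<open>S\<close>, where the chosen
  edges occupy at most \<open>2 * card D\<close> vertices. Fewer edges at \<open>v\<close> are
  blocked by these than \<open>v\<close> has available.\<close>

lemma greedy_matching:
  assumes G: "uniform_hypergraph 3 G" and "finite D" "D \<subseteq> S"
    and heavy: "\<And>v. v \<in> D \<Longrightarrow> 2 * card D * card (verts G) < card {e\<in>edges G. e \<inter> S = {v}}"
  shows "\<exists>g. \<forall>v\<in>D. g v \<in> edges G \<and> g v \<inter> S = {v} \<and> (\<forall>w\<in>D. w \<noteq> v \<longrightarrow> disjnt (g v) (g w))"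
proof -
  \<comment> \<open>The induction runs over subsets \<open>D'\<close> while the threshold stays
    expressed through the fixed set \<open>D\<close>.\<close>
  have "\<exists>g. \<forall>v\<in>D'. g v \<in> edges G \<and> g v \<inter> S = {v} \<and> (\<forall>w\<in>D'. w \<noteq> v \<longrightarrow> disjnt (g v) (g w))"
    if "D' \<subseteq> D" for D'
    using finite_subset[OF that assms(2)] that
  proof (induction D' rule: finite_induct)
    case empty
    then show ?case by simp
  next
    case (insert v D')
    then obtain g where g: "\<And>w. w \<in> D' \<Longrightarrow> g w \<in> edges G \<and> g w \<inter> S = {w}"
        "\<And>w u. w \<in> D' \<Longrightarrow> u \<in> D' \<Longrightarrow> u \<noteq> w \<Longrightarrow> disjnt (g w) (g u)" by auto
    \<comment> \<open>The vertices outside \<open>S\<close> already in use, two for each chosen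
      edge.\<close>
    define U where "U = (\<Union>w\<in>D'. g w - S)"
    have gc: "card (g w - S) = 2" "finite (g w)" if "w \<in> D'" for w
    proof -
      have c3: "card (g w) = 3" using g(1)[OF that] G by (auto simp: uniform_hypergraph_def)
      then show "finite (g w)" by (simp add: card_ge_0_finite)
      moreover have "g w - S = g w - {w}" using g(1)[OF that] by auto
      moreover have "w \<in> g w" using g(1)[OF that] by auto
      ultimately show "card (g w - S) = 2" using c3 by simp
    qed
    have finU: "finite U" using insert.hyps gc by (auto simp: U_def)
    have "card U \<le> (\<Sum>w\<in>D'. card (g w - S))"
      unfolding U_def using insert.hyps by (intro card_UN_le) auto
    also have "\<dots> = 2 * card D'" using gc by simp
    also have "\<dots> \<le> 2 * card D"
      using insert.prems assms(2) by (intro mult_le_mono2 card_mono) auto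
    finally have cU: "card U \<le> 2 * card D" .
    have v: "v \<in> S" "v \<in> D" using insert.prems assms(3) by auto
    have "\<exists>e\<in>edges G. e \<inter> S = {v} \<and> e \<inter> U = {}"
    proof (rule ccontr)
      assume no: "\<not> ?thesis"
      have "card {e\<in>edges G. e \<inter> S = {v}} \<le> card {v} * card U * card (verts G)"
      proof (rule card_edges_through_pair[OF G])
        fix e assume "e \<in> {e\<in>edges G. e \<inter> S = {v}}"
        then have e: "e \<in> edges G" "e \<inter> S = {v}" by auto
        then obtain u where u: "u \<in> e" "u \<in> U" using no by auto
        then have "u \<notin> S" by (auto simp: U_def)
        then show "\<exists>a b. a \<in> {v} \<and> b \<in> U \<and> a \<noteq> b \<and> {a, b} \<subseteq> e" using u e v by auto
      qed (use finU in auto)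
      also have "\<dots> \<le> 2 * card D * card (verts G)" using cU by simp
      finally show False using heavy[OF v(2)] by simp
    qed
    then obtain e where e: "e \<in> edges G" "e \<inter> S = {v}" "e \<inter> U = {}" by auto
    have de: "disjnt e (g w)" if "w \<in> D'" for w
    proof -
      have "x \<notin> g w" if x: "x \<in> e" for x
      proof
        assume xg: "x \<in> g w"
        \<comment> \<open>Outside \<open>S\<close> the vertex would lie in \<open>U\<close>, which
          \<open>e\<close> avoids; inside \<open>S\<close> it would have to equal both
          \<open>v\<close> and \<open>w\<close>.\<close>
        have "x \<in> S" using xg x e(3) \<open>w \<in> D'\<close> by (auto simp: U_def)
        then have "x = v" "x = w" using x xg e(2) g(1)[OF \<open>w \<in> D'\<close>] by auto
        then show False using insert.hyps \<open>w \<in> D'\<close> by simp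
      qed
      then show ?thesis by (auto simp: disjnt_iff)
    qed
    show ?case
    proof (rule exI[of _ "g(v := e)"], intro ballI conjI impI)
      fix w assume w: "w \<in> insert v D'"
      show "(g(v := e)) w \<in> edges G" "(g(v := e)) w \<inter> S = {w}" using w e g(1) by auto
      fix u assume u: "u \<in> insert v D'" "u \<noteq> w"
      consider "w = v" "u \<in> D'" "u \<noteq> v" | "u = v" "w \<in> D'" "w \<noteq> v"
        | "u \<in> D'" "w \<in> D'" "u \<noteq> v" "w \<noteq> v"
        using u w insert.hyps by blast
      then show "disjnt ((g(v := e)) w) ((g(v := e)) u)"
        by cases (use u de g(2) in \<open>simp_all add: disjnt_sym\<close>)
    qed
  qed
  then show ?thesis by blast
qed

section \<open>The upper bound\<close>

text \<open>A clique of size \<open>t\<close> in the link of \<open>v\<close> supplies the leaves of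
  a full star centred at \<open>v\<close>.\<close>

lemma contains_full_starI:
  assumes G: "uniform_hypergraph 3 G" and v: "v \<in> verts G"
    and A: "A \<subseteq> verts G" "v \<notin> A" "card A = t" "t \<ge> 1"
    and clique: "\<And>x y. x \<in> A \<Longrightarrow> y \<in> A \<Longrightarrow> x \<noteq> y \<Longrightarrow> {v, x, y} \<in> edges G"
  shows "contains_copy G (full_star t)"
proof -
  \<comment> \<open>An infinite set has cardinality 0, which \<open>t \<ge> 1\<close> rules
    out.\<close>
  have finA: "finite A" using A(3,4) by (simp add: card_ge_0_finite)
  obtain h where h: "bij_betw h {1..t} A"
    using finite_same_card_bij[of "{1..t}" A] finA A(3) by auto
  define f where "f = h(0 := v)"
  have fA: "f a \<in> A" if "a \<in> {1..t}" for a using h that by (auto simp: f_def bij_betw_def)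
  have f0: "f 0 = v" by (simp add: f_def)
  have "inj_on f {1..t} \<longleftrightarrow> inj_on h {1..t}" by (intro inj_on_cong) (simp add: f_def)
  then have injh: "inj_on f {1..t}" using h by (simp add: bij_betw_def)
  have V: "{..t} = insert 0 {1..t}" by auto
  have "inj_on f {..t}"
    unfolding V using injh fA f0 A(2) by (auto simp: inj_on_insert)
  moreover have "f ` {..t} \<subseteq> verts G" unfolding V using fA f0 A(1) v by auto
  moreover have "f ` e \<in> edges G" if e: "e \<subseteq> {..t}" "card e = 3" "0 \<in> e" for e
  proof -
    have "finite e" using e(1) finite_subset by blast
    then have "card (e - {0}) = 2" using e by simp
    then obtain a b where ab: "e - {0} = {a, b}" "a \<noteq> b" by (auto simp: card_2_iff)
    then have e': "e = {0, a, b}" using e(3) by auto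
    have "a \<in> e - {0}" "b \<in> e - {0}" using ab by auto
    then have r: "a \<in> {1..t}" "b \<in> {1..t}" using e(1) by auto
    then have "f a \<noteq> f b" using injh ab(2) by (meson inj_onD)
    then have "{v, f a, f b} \<in> edges G" using clique fA r by blast
    then show ?thesis by (simp add: e' f0)
  qed
  ultimately show ?thesis
    unfolding contains_copy_def full_star_def by (intro exI[of _ f]) auto
qed

text \<open>Deleting \<open>v\<close> maps \<open>N\<close> injectively to the edges of a graph. A
  clique on \<open>Suc k\<close> vertices in this graph would be a full star at \<open>v\<close>, so
  Turan's bound applies with \<open>r = k\<close>.\<close>

lemma card_link_edges_le:
  assumes G: "uniform_hypergraph 3 G" and k: "k \<ge> 1" and free: "\<not> contains_copy G (full_star (Suc k))"
    and N: "N \<subseteq> edges G" "\<And>e. e \<in> N \<Longrightarrow> v \<in> e"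
  shows "2 * real (card N) \<le> (1 - 1 / real k) * (real (card (verts G)))\<^sup>2"
proof -
  have finV: "finite (verts G)" using G by (auto simp: uniform_hypergraph_def)
  have "edges G \<subseteq> Pow (verts G)" using G by (auto simp: uniform_hypergraph_def)
  then have finN: "finite N" using N(1) finV by (meson finite_Pow_iff finite_subset)
  define L where "L = (\<lambda>e. e - {v}) ` N"
  define E where "E = (\<lambda>x y. {x, y} \<in> L)"
  have inj: "inj_on (\<lambda>e. e - {v}) N"
  proof (rule inj_onI)
    fix e e' assume h: "e \<in> N" "e' \<in> N" "e - {v} = e' - {v}"
    have "e = insert v (e - {v})" "e' = insert v (e' - {v})" using N(2) h by auto
    then show "e = e'" using h(3) by simp
  qed
  have c2: "card e = 2" if "e \<in> L" for e
  proof -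
    obtain e' where "e' \<in> N" "e = e' - {v}" using \<open>e \<in> L\<close> by (auto simp: L_def)
    then show ?thesis using N G by (auto simp: uniform_hypergraph_def)
  qed
  have EN: "{v, x, y} \<in> edges G \<and> v \<noteq> x \<and> v \<noteq> y \<and> {v, x, y} \<subseteq> verts G" if xy: "E x y" for x y
  proof -
    obtain e where e: "e \<in> N" "{x, y} = e - {v}" using xy by (auto simp: E_def L_def)
    then have "{v, x, y} = e" "v \<in> e" "v \<notin> {x, y}" using N(2) by auto
    moreover have "e \<in> edges G" "e \<subseteq> verts G" using e(1) N(1) G by (auto simp: uniform_hypergraph_def)
    ultimately show ?thesis by simp
  qed
  have "finite L" using finN by (simp add: L_def)
  then have "card {(x, y). E x y} = 2 * card L" using card_ordered_pairs[of L] c2 by (simp add: E_def)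
  moreover have "card L = card N" using inj by (simp add: L_def card_image)
  moreover have "{(x, y). E x y} = {(x, y). x \<in> verts G \<and> y \<in> verts G \<and> E x y}"
    using EN by fastforce
  ultimately have cE: "card {(x, y). x \<in> verts G \<and> y \<in> verts G \<and> E x y} = 2 * card N" by simp
  have "k * card {(x, y). x \<in> verts G \<and> y \<in> verts G \<and> E x y} + (card (verts G))\<^sup>2
      \<le> k * (card (verts G))\<^sup>2"
  proof (rule turan_clique_bound[OF finV])
    show "symp E" by (auto simp: symp_def E_def insert_commute)
    show "irreflp E" using c2 by (fastforce simp: irreflp_def E_def)
    fix A assume A: "A \<subseteq> verts G" "card A = Suc k"
    show "\<exists>x\<in>A. \<exists>y\<in>A. x \<noteq> y \<and> \<not> E x y"
    proof (rule ccontr)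
      assume "\<not> ?thesis"
      then have cl: "\<And>x y. x \<in> A \<Longrightarrow> y \<in> A \<Longrightarrow> x \<noteq> y \<Longrightarrow> E x y" by blast
      \<comment> \<open>Since \<open>k \<ge> 1\<close>, the clique has at least two vertices. Each
        of them thus lies on an edge of the link, which is what shows that it differs from
        \<open>v\<close>.\<close>
      have other: "\<exists>y\<in>A. y \<noteq> x" if "x \<in> A" for x
      proof (rule ccontr)
        assume "\<not> ?thesis"
        then have "A \<subseteq> {x}" by blast
        then have "card A \<le> card {x}" by (intro card_mono) auto
        then show False using A(2) k by simp
      qed
      have vA: "x \<noteq> v \<and> v \<in> verts G" if x: "x \<in> A" for x
      proof -
        obtain y where "y \<in> A" "y \<noteq> x" using other[OF x] by auto
        then have "E x y" using cl x by simp
        from EN[OF this] show ?thesis by auto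
      qed
      then have "v \<notin> A" by auto
      moreover have "v \<in> verts G" using A(2) vA by (metis card.empty equals0I nat.distinct(1))
      moreover have "{v, x, y} \<in> edges G" if "x \<in> A" "y \<in> A" "x \<noteq> y" for x y
        using EN[OF cl[OF that]] by simp
      ultimately have "contains_copy G (full_star (Suc k))"
        using A by (intro contains_full_starI[OF G, of v A]) auto
      then show False using free by simp
    qed
  qed
  then have "k * (2 * card N) + (card (verts G))\<^sup>2 \<le> k * (card (verts G))\<^sup>2" by (simp add: cE)
  then have "real (k * (2 * card N) + (card (verts G))\<^sup>2) \<le> real (k * (card (verts G))\<^sup>2)"
    by (simp only: of_nat_le_iff)
  then show ?thesis using k by (simp add: field_simps)
qed

text \<open>A cover \<open>S\<close> of at most \<open>3 * Suc s\<close> vertices splits the edges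
  into those meeting \<open>S\<close> twice and those with trace \<open>{v}\<close>. At most
  \<open>s\<close> heavy vertices contribute the Turan bound each. The linear error collects 9 from
  the edges in \<open>Y\<close> and 6 from the light vertices, in units of \<open>n\<close> times
  the square of \<open>Suc s\<close>.\<close>

lemma card_edges_upper_bound:
  assumes G: "uniform_hypergraph 3 G" and n: "card (verts G) = n" and k: "k \<ge> 1"
    and free: "\<not> contains_copy G (full_star (Suc k))" "\<not> contains_copy G (matching3 (Suc s))"
  shows "real (card (edges G)) \<le>
    real s * ((1 - 1 / real k) * (real n)\<^sup>2 / 2) + 15 * (real (Suc s))\<^sup>2 * real n"
proof -
  have finV: "finite (verts G)" using G by (auto simp: uniform_hypergraph_def)
  have "edges G \<subseteq> Pow (verts G)" using G by (auto simp: uniform_hypergraph_def)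
  then have finE: "finite (edges G)" using finV by (meson finite_Pow_iff finite_subset)
  obtain S where S: "S \<subseteq> verts G" "card S \<le> 3 * Suc s" "\<And>e. e \<in> edges G \<Longrightarrow> e \<inter> S \<noteq> {}"
    using matching_or_cover[OF G, of "Suc s"] contains_matching3I[OF G] free(2) by auto
  have finS: "finite S" using S(1) finV finite_subset by blast
  define N where "N = (\<lambda>v. {e\<in>edges G. e \<inter> S = {v}})"
  define Y where "Y = {e\<in>edges G. \<exists>a b. a \<in> S \<and> b \<in> S \<and> a \<noteq> b \<and> {a, b} \<subseteq> e}"
  \<comment> \<open>The heavy vertices; the threshold is the one that \<open>greedy_matching\<close>
    demands of \<open>Suc s\<close> vertices.\<close>
  define D where "D = {v\<in>S. 2 * Suc s * n < card (N v)}"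
  define T where "T = (1 - 1 / real k) * (real n)\<^sup>2 / 2"
  have NT: "real (card (N v)) \<le> T" for v
  proof -
    have "N v \<subseteq> edges G" "\<And>e. e \<in> N v \<Longrightarrow> v \<in> e" by (auto simp: N_def)
    from card_link_edges_le[OF G k free(1) this] show ?thesis by (simp add: T_def n)
  qed
  \<comment> \<open>Nonnegativity allows \<open>card D\<close> to be replaced by the larger
    \<open>s\<close> in the contribution of the heavy vertices.\<close>
  have T0: "T \<ge> 0" using k by (simp add: T_def)
  have finD: "finite D" using finS by (simp add: D_def)
  have cD: "card D \<le> s"
  proof (rule ccontr)
    assume "\<not> card D \<le> s"
    \<comment> \<open>Exactly \<open>Suc s\<close> heavy vertices are kept, so that the threshold
      matches the size of the set.\<close>
    then obtain D' where D': "D' \<subseteq> D" "card D' = Suc s" "finite D'"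
      using obtain_subset_with_card_n[of "Suc s" D] by auto
    have "\<exists>g. \<forall>v\<in>D'. g v \<in> edges G \<and> g v \<inter> S = {v} \<and> (\<forall>w\<in>D'. w \<noteq> v \<longrightarrow> disjnt (g v) (g w))"
      by (rule greedy_matching[OF G]) (use D' in \<open>auto simp: D_def N_def n\<close>)
    then obtain g where g: "\<And>v. v \<in> D' \<Longrightarrow> g v \<in> edges G" "\<And>v. v \<in> D' \<Longrightarrow> g v \<inter> S = {v}"
      "\<And>v w. v \<in> D' \<Longrightarrow> w \<in> D' \<Longrightarrow> w \<noteq> v \<Longrightarrow> disjnt (g v) (g w)" by blast
    have "inj_on g D'" using g(2) by (metis inj_onI singleton_inject)
    then have "card (g ` D') = Suc s" using D' by (simp add: card_image)
    moreover have "pairwise disjnt (g ` D')" using g(3) by (auto simp: pairwise_def)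
    ultimately have "contains_copy G (matching3 (Suc s))"
      using D' g(1) by (intro contains_matching3I[OF G, of "g ` D'"]) auto
    then show False using free(2) by simp
  qed
  have "edges G \<subseteq> Y \<union> (\<Union>v\<in>S. N v)"
  proof
    fix e assume e: "e \<in> edges G"
    obtain a where a: "a \<in> e" "a \<in> S" using S(3)[OF e] by blast
    show "e \<in> Y \<union> (\<Union>v\<in>S. N v)"
    proof (cases "e \<inter> S = {a}")
      case True
      then show ?thesis using e a by (auto simp: N_def)
    next
      case False
      then obtain b where "b \<in> e" "b \<in> S" "b \<noteq> a" using a by auto
      then show ?thesis using e a by (auto simp: Y_def)
    qed
  qed
  moreover have "finite Y" "finite (\<Union>v\<in>S. N v)" using finE finS by (auto simp: Y_def N_def)
  ultimately have "card (edges G) \<le> card Y + card (\<Union>v\<in>S. N v)"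
    by (meson card_Un_le card_mono finite_Un order_trans)
  moreover have "card (\<Union>v\<in>S. N v) \<le> (\<Sum>v\<in>S. card (N v))" using finS by (rule card_UN_le)
  ultimately have "card (edges G) \<le> card Y + (\<Sum>v\<in>S. card (N v))" by linarith
  then have 1: "real (card (edges G)) \<le> real (card Y) + (\<Sum>v\<in>S. real (card (N v)))"
    by (metis of_nat_add of_nat_le_iff of_nat_sum)
  have "card Y \<le> card S * card S * n"
    using card_edges_through_pair[OF G finS finS, of Y] by (auto simp: Y_def n)
  also have "\<dots> \<le> (3 * Suc s) * (3 * Suc s) * n" using S(2) by (intro mult_le_mono) auto
  finally have "real (card Y) \<le> real ((3 * Suc s) * (3 * Suc s) * n)" by (simp only: of_nat_le_iff)
  then have 2: "real (card Y) \<le> 9 * (real (Suc s))\<^sup>2 * real n"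
    by (simp add: power2_eq_square algebra_simps)
  have "(\<Sum>v\<in>S. real (card (N v))) = (\<Sum>v\<in>D. real (card (N v))) + (\<Sum>v\<in>S - D. real (card (N v)))"
    using finS by (subst add.commute, intro sum.subset_diff) (auto simp: D_def)
  moreover have "(\<Sum>v\<in>D. real (card (N v))) \<le> real s * T"
  proof -
    have "(\<Sum>v\<in>D. real (card (N v))) \<le> real (card D) * T" by (rule sum_bounded_above) (rule NT)
    also have "\<dots> \<le> real s * T" using cD T0 by (intro mult_right_mono) auto
    finally show ?thesis .
  qed
  moreover have "(\<Sum>v\<in>S - D. real (card (N v))) \<le> 6 * (real (Suc s))\<^sup>2 * real n"
  proof -
    have "(\<Sum>v\<in>S - D. card (N v)) \<le> card (S - D) * (2 * Suc s * n)"
    proof -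
      have "card (N v) \<le> 2 * Suc s * n" if "v \<in> S - D" for v
        using that unfolding D_def by (metis (mono_tags, lifting) DiffE mem_Collect_eq not_le_imp_less)
      then have "(\<Sum>v\<in>S - D. card (N v)) \<le> of_nat (card (S - D)) * (2 * Suc s * n)"
        by (rule sum_bounded_above)
      then show ?thesis by simp
    qed
    also have "\<dots> \<le> (3 * Suc s) * (2 * Suc s * n)"
      using S(2) card_mono[OF finS, of "S - D"] by (intro mult_le_mono1) auto
    finally have "real (\<Sum>v\<in>S - D. card (N v)) \<le> real ((3 * Suc s) * (2 * Suc s * n))"
      by (simp only: of_nat_le_iff)
    then show ?thesis by (simp add: power2_eq_square algebra_simps)
  qed
  ultimately show ?thesis using 1 2 unfolding T_def by linarith
qed

section \<open>The extremal construction\<close>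

text \<open>For \<open>i = 1\<close> the set \<open>A1\<close> is empty and \<open>A2\<close> is
  \<open>{..<s}\<close>, so only edges over the Turan graph remain.\<close>

lemma H_graph_1_edges:
  "edges (H_graph l s n 1) = {{a, s + x, s + y} | a x y.
     a < s \<and> x < n - s \<and> y < n - s \<and> x mod (l - 1) \<noteq> y mod (l - 1)}"
  (is "_ = ?R")
proof -
  have "edges (H_graph l s n 1) =
    {insert a ((\<lambda>x. s + x) ` e) | a e. a < s \<and>
      (\<exists>x y. e = {x, y} \<and> x < n - s \<and> y < n - s \<and> x mod (l - 1) \<noteq> y mod (l - 1))}"
    by (simp add: H_graph_def turan_graph_def)
  also have "\<dots> = {insert a ((\<lambda>x. s + x) ` {x, y}) | a x y.
      a < s \<and> x < n - s \<and> y < n - s \<and> x mod (l - 1) \<noteq> y mod (l - 1)}"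
    by blast
  also have "\<dots> = ?R" by simp
  finally show ?thesis .
qed

text \<open>The translated Turan graph starts at \<open>s\<close>, so the low vertex is the one from
  \<open>A2\<close>. Both freeness proofs rest on this.\<close>

lemma H_graph_1_edge_low:
  assumes "e \<in> edges (H_graph l s n 1)"
  shows "\<exists>!a. a \<in> e \<and> a < s"
  using assms unfolding H_graph_1_edges by auto

lemma H_graph_1_card_edges:
  "s * card (edges (turan_graph (n - s) (l - 1))) \<le> card (edges (H_graph l s n 1))"
proof -
  let ?T = "edges (turan_graph (n - s) (l - 1))"
  let ?f = "\<lambda>(a, e). insert a ((\<lambda>x. s + x) ` e)"
  have "inj_on ?f ({..<s} \<times> ?T)"
  proof (rule inj_onI, clarify)
    fix a a' :: nat and e e' :: "nat set"
    assume h: "a < s" "a' < s" "insert a ((\<lambda>x. s + x) ` e) = insert a' ((\<lambda>x. s + x) ` e')"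
    \<comment> \<open>Cutting an edge at \<open>s\<close> recovers the vertex of \<open>A2\<close>
      and the Turan edge, hence injectivity.\<close>
    have low: "insert b ((\<lambda>x. s + x) ` d) \<inter> {..<s} = {b}" if "b < s" for b d using that by auto
    have high: "{x. s + x \<in> insert b ((\<lambda>x. s + x) ` d)} = d" if "b < s" for b d using that by auto
    show "a = a' \<and> e = e'" using h low high by (metis singleton_inject)
  qed
  moreover have "?f ` ({..<s} \<times> ?T) \<subseteq> edges (H_graph l s n 1)"
    unfolding H_graph_def by auto
  moreover have "finite (edges (H_graph l s n 1))"
    unfolding H_graph_1_edges by (rule finite_subset[of _ "Pow {..<n}"]) auto
  ultimately have "card ({..<s} \<times> ?T) \<le> card (edges (H_graph l s n 1))"
    by (metis card_image card_mono)
  then show ?thesis by (simp add: card_cartesian_product)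
qed

lemma H_graph_1_uniform: "uniform_hypergraph 3 (H_graph l s n 1)"
proof -
  have "e \<subseteq> {..<n} \<and> card e = 3" if e_in: "e \<in> edges (H_graph l s n 1)" for e
  proof -
    obtain a x y where e: "e = {a, s + x, s + y}" "a < s" "x < n - s" "y < n - s"
      "x mod (l - 1) \<noteq> y mod (l - 1)"
      using e_in unfolding H_graph_1_edges by blast
    then have "x \<noteq> y" by auto
    then show ?thesis using e by auto
  qed
  then show ?thesis by (auto simp: uniform_hypergraph_def H_graph_def)
qed

text \<open>With the centre in \<open>A2\<close>, the \<open>l\<close> leaves would form a clique in
  a graph with \<open>l - 1\<close> parts. With the centre in \<open>B\<close>, any two leaves would
  have exactly one member in \<open>A2\<close>, impossible for three leaves;
  \<open>l \<ge> 3\<close> supplies these.\<close>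

lemma H_graph_1_full_star_free:
  assumes "l \<ge> 3"
  shows "\<not> contains_copy (H_graph l s n 1) (full_star l)"
proof
  assume "contains_copy (H_graph l s n 1) (full_star l)"
  then obtain f where f: "inj_on f {..l}"
    "\<And>e. e \<subseteq> {..l} \<Longrightarrow> card e = 3 \<Longrightarrow> 0 \<in> e \<Longrightarrow> f ` e \<in> edges (H_graph l s n 1)"
    by (auto simp: contains_copy_def full_star_def)
  have E: "{f 0, f a, f b} \<in> edges (H_graph l s n 1)" if "a \<in> {1..l}" "b \<in> {1..l}" "a \<noteq> b" for a b
    using f(2)[of "{0, a, b}"] that by auto
  have ne: "f a \<noteq> f b" if "a \<le> l" "b \<le> l" "a \<noteq> b" for a b
    using f(1) that by (auto simp: inj_on_def)
  show False
  proof (cases "f 0 < s")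
    case True
    \<comment> \<open>The part of the Turan graph containing the leaf, after undoing the translation
      by \<open>s\<close>.\<close>
    define c where "c = (\<lambda>a. (f a - s) mod (l - 1))"
    have "c a \<noteq> c b" if ab: "a \<in> {1..l}" "b \<in> {1..l}" "a \<noteq> b" for a b
    proof -
      obtain u x y where u: "{f 0, f a, f b} = {u, s + x, s + y}" "u < s"
        "x mod (l - 1) \<noteq> y mod (l - 1)"
        using E[OF ab] unfolding H_graph_1_edges by blast
      have mem: "f 0 \<in> {u, s + x, s + y}" "f a \<in> {u, s + x, s + y}" "f b \<in> {u, s + x, s + y}"
        unfolding u(1)[symmetric] by simp_all
      have "f 0 = u" using mem(1) True by auto
      moreover have "f a \<noteq> f 0" "f b \<noteq> f 0" "f a \<noteq> f b" using ne ab by auto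
      ultimately have "f a = s + x \<and> f b = s + y \<or> f a = s + y \<and> f b = s + x"
        using mem(2,3) by auto
      then show ?thesis using u(3) by (auto simp: c_def)
    qed
    then have "inj_on c {1..l}" by (meson inj_onI)
    moreover have "c ` {1..l} \<subseteq> {..<l - 1}" using assms by (auto simp: c_def)
    ultimately have "card {1..l} \<le> card {..<l - 1}" by (metis card_inj_on_le finite_lessThan)
    then show False using assms by simp
  next
    case False
    \<comment> \<open>The centre is not the low vertex of the edge, so exactly one of the two leaves
      is.\<close>
    have low: "(f a < s) \<noteq> (f b < s)" if ab: "a \<in> {1..l}" "b \<in> {1..l}" "a \<noteq> b" for a b
      using H_graph_1_edge_low[OF E[OF ab]] False ne[of a b] ab by auto
    show False using low[of 1 2] low[of 1 3] low[of 2 3] assms by auto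
  qed
qed

text \<open>Disjoint edges would use different vertices of \<open>A2\<close>, and there are only
  \<open>s\<close> of these.\<close>

lemma H_graph_1_matching_free: "\<not> contains_copy (H_graph l s n 1) (matching3 (Suc s))"
proof
  assume "contains_copy (H_graph l s n 1) (matching3 (Suc s))"
  then obtain f where f: "inj_on f {..<3 * Suc s}"
      "\<And>e. e \<in> edges (matching3 (Suc s)) \<Longrightarrow> f ` e \<in> edges (H_graph l s n 1)"
    by (auto simp: contains_copy_def matching3_def)
  have E: "f ` {3 * j, 3 * j + 1, 3 * j + 2} \<in> edges (H_graph l s n 1)" if "j < Suc s" for j
    using that by (intro f(2)) (auto simp: matching3_def)
  \<comment> \<open>Recording \<open>i div 3 = j\<close> keeps the vertices chosen for different
    edges distinct.\<close>
  have "\<exists>i. i div 3 = j \<and> f i < s" if j: "j < Suc s" for j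
  proof -
    obtain i where "i \<in> {3 * j, 3 * j + 1, 3 * j + 2}" "f i < s"
      using H_graph_1_edge_low[OF E[OF j]] by blast
    moreover from this have "i div 3 = j" by auto
    ultimately show ?thesis by blast
  qed
  then obtain g where g: "\<And>j. j < Suc s \<Longrightarrow> g j div 3 = j \<and> f (g j) < s" by metis
  have "g j < 3 * Suc s" if "j < Suc s" for j
  proof -
    have "g j div 3 < Suc s" using g[OF that] that by simp
    then show ?thesis by (simp only: less_eq_Suc_le div_less_iff_less_mult) presburger
  qed
  then have "inj_on (\<lambda>j. f (g j)) {..<Suc s}"
    using f(1) g by (intro inj_onI) (metis inj_onD lessThan_iff)
  moreover have "(\<lambda>j. f (g j)) ` {..<Suc s} \<subseteq> {..<s}" using g by auto
  ultimately have "card {..<Suc s} \<le> card {..<s}" by (metis card_inj_on_le finite_lessThan)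
  then show False by simp
qed

section \<open>Parameters of the full star\<close>

lemma full_star_edge_iff:
  "e \<in> edges (full_star t) \<longleftrightarrow> (\<exists>a b. e = {0, a, b} \<and> 1 \<le> a \<and> a < b \<and> b \<le> t)"
proof
  assume "e \<in> edges (full_star t)"
  then have e: "e \<subseteq> {..t}" "card e = 3" "0 \<in> e" by (auto simp: full_star_def)
  have "finite e" using e(1) finite_subset by blast
  then have "card (e - {0}) = 2" using e by simp
  then obtain a b where ab: "e - {0} = {a, b}" "a < b"
    by (metis card_2_iff insert_commute linorder_neqE_nat)
  then have "a \<in> e - {0}" "b \<in> e - {0}" by auto
  moreover have "e = {0, a, b}" using ab e(3) by auto
  ultimately show "\<exists>a b. e = {0, a, b} \<and> 1 \<le> a \<and> a < b \<and> b \<le> t"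
    using ab(2) e(1) by (intro exI[of _ a] exI[of _ b]) auto
qed (auto simp: full_star_def)

lemma full_star_pair_iff:
  "{0, a, b} \<in> edges (full_star t) \<longleftrightarrow> a \<in> {1..t} \<and> b \<in> {1..t} \<and> a \<noteq> b"
  by (auto simp: full_star_def card_insert_if split: if_splits)

lemma chromatic_number_le:
  assumes "c ` verts G \<subseteq> {..<k}" "proper_colouring G c"
  shows "chromatic_number G \<le> k"
  unfolding chromatic_number_def using assms by (intro Least_le) blast

lemma chromatic_number_eq:
  assumes "c ` verts G \<subseteq> {..<k}" "proper_colouring G c"
    and "\<And>k' c. c ` verts G \<subseteq> {..<k'} \<Longrightarrow> proper_colouring G c \<Longrightarrow> k \<le> k'"
  shows "chromatic_number G = k"
  unfolding chromatic_number_def using assms by (intro Least_equality) blast+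

text \<open>Every edge joins the centre to leaves, so giving the centre its own colour suffices;
  \<open>t \<ge> 2\<close> guarantees an edge, which needs two colours.\<close>

lemma full_star_chromatic_number:
  assumes "t \<ge> 2"
  shows "chromatic_number (full_star t) = 2"
proof (rule chromatic_number_eq)
  show "(\<lambda>x. if x = 0 then 0 else 1) ` verts (full_star t) \<subseteq> {..<2::nat}" by auto
  show "proper_colouring (full_star t) (\<lambda>x. if x = 0 then 0 else 1)"
    unfolding proper_colouring_def
  proof
    fix e assume "e \<in> edges (full_star t)"
    then obtain a where "0 \<in> e" "a \<in> e" "a \<ge> 1" by (auto simp: full_star_edge_iff)
    then show "\<exists>x\<in>e. \<exists>y\<in>e. (if x = 0 then 0 else 1::nat) \<noteq> (if y = 0 then 0 else 1)"
      by (intro bexI[of _ 0] bexI[of _ a]) auto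
  qed
  fix k' and c :: "nat \<Rightarrow> nat"
  assume c: "c ` verts (full_star t) \<subseteq> {..<k'}" "proper_colouring (full_star t) c"
  have "{0, 1, 2} \<in> edges (full_star t)" using assms by (subst full_star_pair_iff) auto
  then obtain x y where "x \<in> {0, 1, 2}" "y \<in> {0, 1, 2}" "c x \<noteq> c y"
    using c(2) unfolding proper_colouring_def by blast
  moreover from this have "x \<in> verts (full_star t)" "y \<in> verts (full_star t)"
    using assms by (auto simp: full_star_def)
  then have "c x < k'" "c y < k'" using c(1) by auto
  ultimately show "2 \<le> k'" by linarith
qed

text \<open>The centre alone may be red, and the edge \<open>{0, 1, 2}\<close> forces some red
  vertex. Hence only \<open>H_1\<close> enters the predicted maximum.\<close>

lemma full_star_q_number:
  assumes "t \<ge> 2"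
  shows "q_number (full_star t) = 1"
proof (rule antisym)
  have "e \<inter> {0} = {0}" if "e \<in> edges (full_star t)" for e
    using that by (auto simp: full_star_def)
  then have "strong_red_blue (full_star t) {0}"
    by (auto simp: strong_red_blue_def full_star_def)
  then have "q_number (full_star t) \<le> enat (card {0::nat})"
    unfolding q_number_def by (intro Inf_lower) blast
  then show "q_number (full_star t) \<le> 1" by (simp add: one_enat_def)
  have "{0, 1, 2} \<in> edges (full_star t)" using assms by (subst full_star_pair_iff) auto
  moreover have "finite (verts (full_star t))" by (simp add: full_star_def)
  ultimately have "1 \<le> card R" if "strong_red_blue (full_star t) R" for R
    using that unfolding strong_red_blue_def
    by (metis One_nat_def Suc_leI card_gt_0_iff finite_subset inf_bot_right card.empty zero_neq_one)
  then show "1 \<le> q_number (full_star t)"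
    unfolding q_number_def by (intro Inf_greatest) (auto simp: one_enat_def)
qed

text \<open>The link of the centre is the complete graph on \<open>{1..t}\<close>, so a colouring is
  proper exactly when it is injective there; the shift by 1 makes the colours start at 0.\<close>

lemma full_star_link_0_chromatic_number: "chromatic_number (link (full_star t) 0) = t"
proof (rule chromatic_number_eq)
  show "(\<lambda>x. x - 1) ` verts (link (full_star t) 0) \<subseteq> {..<t}"
    by (auto simp: link_def full_star_def)
  have eq: "edges (link (full_star t) 0) = {{x, y} | x y. x \<in> {1..t} \<and> y \<in> {1..t} \<and> x \<noteq> y}"
  proof -
    have "x \<noteq> y \<and> x \<noteq> 0 \<and> y \<noteq> 0 \<and> {0, x, y} \<in> edges (full_star t)
        \<longleftrightarrow> x \<in> {1..t} \<and> y \<in> {1..t} \<and> x \<noteq> y" for x y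
      by (auto simp: full_star_pair_iff)
    then show ?thesis by (simp only: link_def hypergraph.sel)
  qed
  show "proper_colouring (link (full_star t) 0) (\<lambda>x. x - 1)"
    unfolding proper_colouring_def eq by fastforce
  fix k' c
  assume c: "c ` verts (link (full_star t) 0) \<subseteq> {..<k'}" "proper_colouring (link (full_star t) 0) c"
  have "inj_on c {1..t}"
  proof (rule inj_onI, rule ccontr)
    fix x y assume "x \<in> {1..t}" "y \<in> {1..t}" "c x = c y" "x \<noteq> y"
    then have "{x, y} \<in> edges (link (full_star t) 0)" unfolding eq by blast
    then show False using c(2) \<open>c x = c y\<close> by (auto simp: proper_colouring_def)
  qed
  moreover have "{1..t} = verts (link (full_star t) 0)" by (auto simp: link_def full_star_def)
  ultimately have "card {1..t} \<le> card {..<k'}" using c(1) by (metis card_inj_on_le finite_lessThan)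
  then show "t \<le> k'" by simp
qed

text \<open>All edges of the link of a leaf pass through the centre. The bound 2 separates leaves
  from the centre when vertices are ordered by their links.\<close>

lemma full_star_link_leaf_chromatic_number:
  assumes "u \<noteq> 0"
  shows "chromatic_number (link (full_star t) u) \<le> 2"
proof (rule chromatic_number_le)
  show "(\<lambda>x. if x = 0 then 0 else 1) ` verts (link (full_star t) u) \<subseteq> {..<2::nat}" by auto
  show "proper_colouring (link (full_star t) u) (\<lambda>x. if x = 0 then 0 else 1)"
    unfolding proper_colouring_def
  proof
    fix e assume "e \<in> edges (link (full_star t) u)"
    then obtain x y where e: "e = {x, y}" "x \<noteq> y" and "{u, x, y} \<in> edges (full_star t)"
      by (auto simp: link_def)
    then have "x = 0 \<or> y = 0" using assms by (auto simp: full_star_def)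
    then show "\<exists>x\<in>e. \<exists>y\<in>e. (if x = 0 then 0 else 1::nat) \<noteq> (if y = 0 then 0 else 1)"
      using e by (intro bexI[of _ x] bexI[of _ y]) auto
  qed
qed

text \<open>For \<open>t \<ge> 3\<close> the link of the centre has strictly the largest chromatic
  number, so every admissible ordering starts with the centre.\<close>

lemma full_star_link_ordering_hd:
  assumes "t \<ge> 3" "link_ordering (full_star t) vs"
  shows "vs ! 0 = 0"
proof (cases vs)
  case Nil
  then show ?thesis using assms by (auto simp: link_ordering_def full_star_def)
next
  case (Cons u ws)
  have "0 \<in> set vs" using assms by (auto simp: link_ordering_def full_star_def)
  have "u = 0"
  proof (rule ccontr)
    assume u: "u \<noteq> 0"
    then have "0 \<in> set ws" using \<open>0 \<in> set vs\<close> Cons by auto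
    then have "chromatic_number (link (full_star t) 0) \<le> chromatic_number (link (full_star t) u)"
      using assms(2) Cons by (auto simp: link_ordering_def)
    then show False
      using full_star_link_leaf_chromatic_number[OF u, of t] assms(1)
      by (simp add: full_star_link_0_chromatic_number)
  qed
  then show ?thesis using Cons by simp
qed

section \<open>The Turan number of full stars and the asymptotic equality\<close>

lemma finite_turan_ex_set:
  "finite {card (edges G) | G :: nat hypergraph.
     uniform_hypergraph 3 G \<and> card (verts G) = n \<and> (\<forall>F\<in>\<F>. \<not> contains_copy G F)}"
proof (rule finite_subset[of _ "{..2 ^ n}"])
  show "{card (edges G) | G :: nat hypergraph.
     uniform_hypergraph 3 G \<and> card (verts G) = n \<and> (\<forall>F\<in>\<F>. \<not> contains_copy G F)} \<subseteq> {..2 ^ n}"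
  proof safe
    fix G :: "nat hypergraph"
    assume G: "uniform_hypergraph 3 G"
    \<comment> \<open>Counting all vertex subsets is a crude bound, but finiteness is all that the
      \<open>Max\<close> in \<open>turan_ex\<close> requires.\<close>
    have "edges G \<subseteq> Pow (verts G)" "finite (verts G)" using G by (auto simp: uniform_hypergraph_def)
    then have "card (edges G) \<le> card (Pow (verts G))" by (intro card_mono) auto
    then show "card (edges G) \<le> 2 ^ card (verts G)"
      using \<open>finite (verts G)\<close> by (simp add: card_Pow)
  qed
qed simp

text \<open>In \<open>C\<close> the first summand is the error of the upper bound. The second is the
  loss of \<open>s\<close> copies of the Turan graph on \<open>n - s\<close> vertices against the
  leading term in \<open>n\<close>, at most \<open>(real s + 1) * real n\<close> per copy.\<close>

lemma full_star_turan_ex_bounds: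
  assumes "t \<ge> 3" "n \<ge> s"
  defines "C \<equiv> 15 * (real (Suc s))\<^sup>2 + real s * (real s + 1)"
  shows "card (edges (H_graph t s n 1)) \<le> turan_ex n {full_star t, matching3 (s + 1)}"
    and "real (turan_ex n {full_star t, matching3 (s + 1)})
          \<le> real (card (edges (H_graph t s n 1))) + C * real n"
proof -
  let ?F = "{full_star t, matching3 (s + 1)}"
  let ?A = "{card (edges G) | G :: nat hypergraph.
     uniform_hypergraph 3 G \<and> card (verts G) = n \<and> (\<forall>F\<in>?F. \<not> contains_copy G F)}"
  let ?H = "H_graph t s n 1"
  have H: "card (edges ?H) \<in> ?A"
    using H_graph_1_uniform H_graph_1_full_star_free[OF assms(1)] H_graph_1_matching_free
    by (intro CollectI exI[of _ ?H]) (auto simp: H_graph_def)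
  show "card (edges ?H) \<le> turan_ex n ?F"
    unfolding turan_ex_def using finite_turan_ex_set H by (rule Max_ge)
  have "turan_ex n ?F \<in> ?A"
    unfolding turan_ex_def using finite_turan_ex_set H by (intro Max_in) blast+
  \<comment> \<open>An extremal graph; \<open>t\<close> is written as \<open>Suc (t - 1)\<close> to
    apply the upper bound with \<open>k = t - 1\<close>.\<close>
  then obtain G :: "nat hypergraph" where G: "uniform_hypergraph 3 G" "card (verts G) = n"
    "\<not> contains_copy G (full_star (Suc (t - 1)))" "\<not> contains_copy G (matching3 (Suc s))"
    "turan_ex n ?F = card (edges G)"
    using assms(1) by auto
  define q where "q = 1 - 1 / real (t - 1)"
  have q: "0 \<le> q" "q \<le> 1" using assms(1) by (auto simp: q_def)
  have up: "real (turan_ex n ?F) \<le> real s * (q * (real n)\<^sup>2 / 2) + 15 * (real (Suc s))\<^sup>2 * real n"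
    unfolding G(5) q_def using assms(1) by (intro card_edges_upper_bound[OF G(1,2) _ G(3,4)]) simp
  have "q * (real (n - s))\<^sup>2 - real (n - s) \<le> 2 * real (card (edges (turan_graph (n - s) (t - 1))))"
    using card_turan_graph_edges[of "t - 1" "n - s"] assms(1) by (simp add: q_def)
  \<comment> \<open>Dropping \<open>s\<close> vertices changes the square by at most
    \<open>2 * s * n\<close>, and \<open>q\<close> is at most 1.\<close>
  moreover have "q * (real n)\<^sup>2 \<le> q * (real (n - s))\<^sup>2 + 2 * real s * real n"
  proof -
    have "q * ((real n)\<^sup>2 - (real (n - s))\<^sup>2) \<le> 1 * (2 * real s * real n)"
      using q assms(2)
      by (intro mult_mono) (auto simp: of_nat_diff power2_eq_square algebra_simps intro: mult_mono)
    then show ?thesis by (simp add: algebra_simps)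
  qed
  ultimately have "q * (real n)\<^sup>2 / 2
      \<le> real (card (edges (turan_graph (n - s) (t - 1)))) + (real s + 1) * real n"
    using assms(2) by (simp add: of_nat_diff algebra_simps)
  then have "real s * (q * (real n)\<^sup>2 / 2)
      \<le> real s * (real (card (edges (turan_graph (n - s) (t - 1)))) + (real s + 1) * real n)"
    by (intro mult_left_mono) auto
  moreover have "real s * real (card (edges (turan_graph (n - s) (t - 1)))) \<le> real (card (edges ?H))"
    using H_graph_1_card_edges[of s n t] by (metis of_nat_le_iff of_nat_mult)
  ultimately show "real (turan_ex n ?F) \<le> real (card (edges ?H)) + C * real n"
    using up unfolding C_def by (simp add: algebra_simps)
qed

text \<open>The difference from the prediction lies between 0 and a constant times \<open>n\<close>,
  so it is even linear in \<open>n\<close>.\<close>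

lemma full_star_satisfies_GTZ:
  assumes "t \<ge> 3"
  shows "satisfies_GTZ (full_star t)"
proof -
  have "GTZ_asymptotics (full_star t) s" for s
    unfolding GTZ_asymptotics_def
  proof (intro allI impI)
    fix vs assume vs: "link_ordering (full_star t) vs"
    \<comment> \<open>Since \<open>q = 1\<close>, the maximum ranges over a single graph, whose
      parameter is the link of the centre.\<close>
    have i1: "1 \<le> i \<and> enat i \<le> q_number (full_star t) \<longleftrightarrow> i = 1" for i
      using full_star_q_number[of t] assms by (auto simp: one_enat_def)
    have H: "Max {card (edges (GTZ_H (full_star t) vs s n i)) | i.
          1 \<le> i \<and> enat i \<le> q_number (full_star t)} = card (edges (H_graph t s n 1))" for n
      unfolding i1 using full_star_link_ordering_hd[OF assms vs]
      by (simp add: GTZ_H_def full_star_link_0_chromatic_number)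
    let ?d = "\<lambda>n. real (turan_ex n {full_star t, matching3 (s + 1)})
        - real (card (edges (H_graph t s n 1)))"
    define C where "C = 15 * (real (Suc s))\<^sup>2 + real s * (real s + 1)"
    have "eventually (\<lambda>n. norm (?d n) \<le> C * norm (real n)) at_top"
      using eventually_ge_at_top[of s]
    proof eventually_elim
      case (elim n)
      show ?case
        using full_star_turan_ex_bounds[OF assms elim] unfolding C_def
        by (simp add: abs_le_iff)
    qed
    then have "?d \<in> O(\<lambda>n. real n)" by (rule bigoI)
    moreover have "(\<lambda>n. real n) \<in> o(\<lambda>n. (real n)\<^sup>2)"
    proof (rule smalloI_tendsto)
      have "((\<lambda>n. 1 / real n) \<longlongrightarrow> 0) at_top" by (rule lim_1_over_n)
      \<comment> \<open>At \<open>n = 0\<close> both sides are 0 by the convention for division by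
        zero.\<close>
      moreover have "(\<lambda>n. real n / (real n)\<^sup>2) = (\<lambda>n. 1 / real n)"
        by (auto simp: power2_eq_square)
      ultimately show "((\<lambda>n. real n / (real n)\<^sup>2) \<longlongrightarrow> 0) at_top" by simp
      show "\<forall>\<^sub>F n in at_top. (real n)\<^sup>2 \<noteq> 0"
        using eventually_gt_at_top[of 0] by eventually_elim auto
    qed
    ultimately have "?d \<in> o(\<lambda>n. (real n)\<^sup>2)" by (rule landau_o.big_small_trans)
    then show "(\<lambda>n. real (turan_ex n {full_star t, matching3 (s + 1)})
        - real (Max {card (edges (GTZ_H (full_star t) vs s n i)) | i.
            1 \<le> i \<and> enat i \<le> q_number (full_star t)})) \<in> o(\<lambda>n. (real n)\<^sup>2)"
      unfolding H .
  qed
  then show ?thesis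
    using full_star_chromatic_number[of t] full_star_q_number[of t] assms
    by (simp add: satisfies_GTZ_def)
qed

text \<open>The number of vertices \<open>Suc t\<close> tells the members apart, which yields both
  infinitude and pairwise non-isomorphism.\<close>

lemma infinite_family_full_star: "infinite_family {full_star t | t. t \<ge> m}"
proof -
  have cv: "card (verts (full_star t)) = Suc t" for t by (simp add: full_star_def)
  have "inj full_star" using cv by (metis injI nat.inject)
  then have "infinite (full_star ` {m..})"
    using finite_image_iff[of full_star "{m..}"] infinite_Ici by (metis inj_on_subset subset_UNIV)
  moreover have "{full_star t | t. t \<ge> m} = full_star ` {m..}" by auto
  moreover have "uniform_hypergraph 3 (full_star t)" for t
    by (auto simp: uniform_hypergraph_def full_star_def)
  moreover have "\<not> isomorphic (full_star t) (full_star u)" if "full_star t \<noteq> full_star u" for t u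
    using that cv unfolding isomorphic_def by (metis bij_betw_same_card nat.inject)
  ultimately show ?thesis by (auto simp: infinite_family_def pairwise_def)
qed

theorem corollary5p1:
  "(\<exists>\<F>. infinite_family \<F> \<and> (\<forall>F\<in>\<F>. satisfies_GTZ F)) \<and>
   infinite_family {full_star t | t. t \<ge> 3} \<and>
   (\<forall>t\<ge>3. satisfies_GTZ (full_star t))"
  using infinite_family_full_star[of 3] full_star_satisfies_GTZ by blast

end
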